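(* Let $L\subseteq\{0,1\}^*$ be a 0-1-symmetric language. Then $\mathcal{G}_L$ is hereditary, i.e., closed under taking induced subgraphs: if $G\in\mathcal{G}_L$ and $A$ is a nonempty subset of the vertex set of $G$, then the induced subgraph $G[A]$ belongs to $\mathcal{G}_L$.
   Context: All graphs are finite, simple, undirected, with nonempty vertex sets, and graph classes are considered up to isomorphism. For $w\in\{0,1\}^*$ let $\widetilde{w}$ be obtained from $w$ by exchanging the letters 0 and 1; a language $L\subseteq\{0,1\}^*$ is 0-1-symmetric if $L=\{\widetilde w : w\in L\}$. For an alphabet $V$ and distinct $u,v\in V$, $h_{u,v}:V^*\to\{0,1\}^*$ is the monoid morphism with $u\mapsto 0$, $v\mapsto 1$ and $x\mapsto\lambda$ (empty word) for all other letters $x$. For a 0-1-symmetric $L$ and a nonempty word $w$ whose set of occurring letters is $V$, $G(L,w)$ is the graph with vertex set $V$ in which distinct $u,v$ are adjacent iff $h_{u,v}(w)\in L$. A graph is $L$-representable if it is isomorphic to some $G(L,w)$, and $\mathcal{G}_L$ denotes the class of all $L$-representable graphs. *)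

theory Defs
  imports "Graph_Theory.Digraph_Isomorphism"
begin

text \<open>
  Words over \<open>{0,1}\<close> are Boolean lists, with \<open>False\<close> for the letter 0 and \<open>True\<close> for the letter 1.
\<close>

definition complement_word :: "bool list \<Rightarrow> bool list" where
  "complement_word w = map Not w"

definition zero_one_symmetric :: "bool list set \<Rightarrow> bool" where
  "zero_one_symmetric L \<longleftrightarrow> L = complement_word ` L"

definition proj_word :: "'v \<Rightarrow> 'v \<Rightarrow> 'v list \<Rightarrow> bool list" where
  "proj_word u v w =
     concat (map (\<lambda>x. if x = u then [False] else if x = v then [True] else []) w)"

text \<open>
  Undirected graphs are symmetric digraphs, as in the locale \<open>graph\<close>: an edge between
  \<open>u\<close> and \<open>v\<close> is the pair of arcs \<open>(u, v)\<close> and \<open>(v, u)\<close>. Symmetry of \<open>word_graph L w\<close> depends on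
  0-1-symmetry of \<open>L\<close>; see \<open>graph_word_graph\<close>.
\<close>

definition word_graph :: "bool list set \<Rightarrow> 'v list \<Rightarrow> ('v, 'v \<times> 'v) pre_digraph" where
  "word_graph L w =
     \<lparr> verts = set w,
       arcs = {(u, v). u \<in> set w \<and> v \<in> set w \<and> u \<noteq> v \<and> proj_word u v w \<in> L},
       tail = fst, head = snd \<rparr>"

text \<open>
  Letters of representing words are natural numbers. As the set of letters of a word is finite,
  this is no restriction; see \<open>representable_graphsI\<close>.
\<close>

definition representable_graphs :: "bool list set \<Rightarrow> ('a, 'b) pre_digraph set" where
  "representable_graphs L =
     {G. graph G \<and> verts G \<noteq> {} \<and>
         (\<exists>w :: nat list. w \<noteq> [] \<and> digraph_iso G (word_graph L w))}"

definition hereditary :: "('a, 'b) pre_digraph set \<Rightarrow> bool" where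
  "hereditary C \<longleftrightarrow>
     (\<forall>G \<in> C. \<forall>A. A \<noteq> {} \<and> A \<subseteq> verts G \<longrightarrow> G \<restriction> A \<in> C)"

lemma proj_word_swap: "u \<noteq> v \<Longrightarrow> proj_word v u w = complement_word (proj_word u v w)"
  by (induction w) (auto simp: proj_word_def complement_word_def)

lemma graph_word_graph:
  assumes "zero_one_symmetric L"
  shows "graph (word_graph L w)"
proof -
  have sym: "proj_word v u w \<in> L" if "proj_word u v w \<in> L" "u \<noteq> v" for u v
    using assms that proj_word_swap[of u v w] unfolding zero_one_symmetric_def by blast
  have "finite {(u, v). u \<in> set w \<and> v \<in> set w \<and> u \<noteq> v \<and> proj_word u v w \<in> L}"
    by (rule finite_subset[of _ "set w \<times> set w"]) auto
  then show ?thesis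
    by unfold_locales
      (auto simp: word_graph_def arc_to_ends_def symmetric_conv intro: sym)
qed

lemma proj_word_map:
  assumes "inj_on f (insert u (insert v (set w)))"
  shows "proj_word (f u) (f v) (map f w) = proj_word u v w"
  using assms by (induction w) (auto simp: proj_word_def inj_on_def)

lemma word_graph_map:
  assumes "inj_on f (set w)"
  shows "digraph_iso (word_graph L w) (word_graph L (map f w))"
proof -
  define h where "h = \<lparr> iso_verts = f, iso_arcs = map_prod f f, iso_head = snd, iso_tail = fst \<rparr>"
  have proj: "proj_word (f u) (f v) (map f w) = proj_word u v w" if "u \<in> set w" "v \<in> set w" for u v
    using assms that by (intro proj_word_map) (simp add: insert_absorb)
  have "pre_digraph.digraph_isomorphism (word_graph L w) h"
    using assms unfolding pre_digraph.digraph_isomorphism_def h_def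
    by (auto simp: word_graph_def wf_digraph_def inj_on_def)
  moreover have "word_graph L (map f w) = app_iso h (word_graph L w)"
    using inj_onD[OF assms]
    by (force simp: word_graph_def app_iso_def h_def proj image_iff)
  ultimately show ?thesis
    unfolding digraph_iso_def by blast
qed

lemma representable_graphsI:
  fixes G :: "('a, 'b) pre_digraph" and w :: "'v list"
  assumes "graph G" "w \<noteq> []" "digraph_iso G (word_graph L w)"
  shows "G \<in> representable_graphs L"
proof -
  obtain f :: "'v \<Rightarrow> nat" where f: "inj_on f (set w)"
    using finite_imp_inj_to_nat_seg[of "set w"] by auto
  have "digraph_iso G (word_graph L (map f w))"
    using assms(3) word_graph_map[OF f] by (rule digraph_iso_trans)
  moreover have "verts G \<noteq> {}"
    using assms(2,3) by (auto simp: digraph_iso_def word_graph_def app_iso_def)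
  ultimately show ?thesis
    using assms(1,2) unfolding representable_graphs_def
    by (auto intro!: exI[of _ "map f w"])
qed

end

theory Submission
  imports Defs
begin

text \<open>
  If \<open>w\<close> represents \<open>G\<close>, delete from \<open>w\<close> the letters of the vertices outside \<open>A\<close>: for
  remaining letters \<open>u\<close> and \<open>v\<close> this does not change \<open>h\<^sub>u\<^sub>v(w)\<close>, so the shorter word represents
  \<open>G[A]\<close>.
\<close>

lemma proj_word_filter:
  assumes "u \<in> B" "v \<in> B"
  shows "proj_word u v (filter (\<lambda>x. x \<in> B) w) = proj_word u v w"
  using assms by (induction w) (auto simp: proj_word_def)

text \<open>The assumption makes \<open>B\<close> exactly the set of letters of the filtered word;
  in general that set is only the intersection of \<open>B\<close> with
  \<open>set w\<close>.\<close>

lemma word_graph_filter: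
  assumes "B \<subseteq> set w"
  shows "word_graph L (filter (\<lambda>x. x \<in> B) w) = word_graph L w \<restriction> B"
  using assms
  by (auto simp: word_graph_def induce_subgraph_def proj_word_filter)

text \<open>Since \<open>hom\<close> is injective on vertices, an end of an arc is mapped into the
  image of \<open>A\<close> only if it lies in \<open>A\<close>, so the same arcs survive on both
  sides.\<close>

lemma (in pre_digraph) app_iso_induce_subgraph:
  assumes hom: "digraph_isomorphism hom" and A: "A \<subseteq> verts G"
  shows "app_iso hom (G \<restriction> A) = app_iso hom G \<restriction> (iso_verts hom ` A)"
proof -
  interpret wf_digraph G
    using hom by (simp add: digraph_isomorphism_def)
  have mem: "iso_verts hom x \<in> iso_verts hom ` A \<longleftrightarrow> x \<in> A" if "x \<in> verts G" for x
    using inj_on_image_mem_iff[OF digraph_isomorphism_inj_on_verts[OF hom] that A] .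
  have "iso_tail hom (iso_arcs hom e) \<in> iso_verts hom ` A \<longleftrightarrow> tail G e \<in> A"
    and "iso_head hom (iso_arcs hom e) \<in> iso_verts hom ` A \<longleftrightarrow> head G e \<in> A"
    if "e \<in> arcs G" for e
    using that hom by (simp_all add: iso_verts_tail iso_verts_head mem)
  then have "iso_arcs hom ` arcs (G \<restriction> A) = arcs (app_iso hom G \<restriction> (iso_verts hom ` A))"
    by auto
  then show ?thesis
    by (simp add: app_iso_def induce_subgraph_def)
qed

lemma (in pre_digraph) digraph_isomorphism_induce_subgraph:
  assumes hom: "digraph_isomorphism hom" and A: "A \<subseteq> verts G"
  shows "pre_digraph.digraph_isomorphism (G \<restriction> A) hom"
proof -
  interpret wf_digraph G
    using hom by (simp add: digraph_isomorphism_def)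
  have "wf_digraph (G \<restriction> A)"
    by (rule wellformed_induce_subgraph)
  then show ?thesis
    using hom A by (auto simp: pre_digraph.digraph_isomorphism_def intro: inj_on_subset)
qed

text \<open>Symmetry survives because an induced subgraph keeps an arc together with its reverse;
  finiteness and the absence of loops and multiple arcs pass to subgraphs.\<close>

lemma (in graph) graph_induce_subgraph:
  assumes "A \<subseteq> verts G"
  shows "graph (G \<restriction> A)"
proof -
  interpret H: wf_digraph "G \<restriction> A"
    by (rule wellformed_induce_subgraph)
  have "symmetric (G \<restriction> A)"
    using induced_induce[OF assms] sym_arcs by (rule induced_graph_imp_symmetric[rotated])
  then show ?thesis
    using finite_subset[OF assms finite_verts] no_loops no_multi_arcs
    by unfold_locales (auto simp: arc_to_ends_def)
qed

theorem mainTheorem1: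
  fixes L :: "bool list set"
  assumes "zero_one_symmetric L"
  shows "hereditary (representable_graphs L :: ('a, 'b) pre_digraph set)"
  unfolding hereditary_def
proof (intro ballI allI impI)
  fix G :: "('a, 'b) pre_digraph" and A
  assume "G \<in> representable_graphs L" and A: "A \<noteq> {} \<and> A \<subseteq> verts G"
  then obtain w :: "nat list" and hom where G: "graph G"
    and hom: "pre_digraph.digraph_isomorphism G hom" and w: "word_graph L w = app_iso hom G"
    unfolding representable_graphs_def digraph_iso_def by blast
  \<comment> \<open>The letters of \<open>w\<close> are the images of the vertices of
    \<open>G\<close> under \<open>hom\<close>; those to be kept are the images of
    \<open>A\<close>.\<close>
  define B where "B = iso_verts hom ` A"
  define w' where "w' = filter (\<lambda>x. x \<in> B) w"
  have "set w = iso_verts hom ` verts G"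
    using arg_cong[OF w, of verts] by (simp add: word_graph_def)
  then have B: "B \<subseteq> set w" "B \<noteq> {}"
    using A unfolding B_def by auto
  have "word_graph L w' = app_iso hom (G \<restriction> A)"
    using pre_digraph.app_iso_induce_subgraph[OF hom] A word_graph_filter[OF B(1)] w
    by (simp add: w'_def B_def)
  then have "digraph_iso (G \<restriction> A) (word_graph L w')"
    unfolding digraph_iso_def
    using pre_digraph.digraph_isomorphism_induce_subgraph[OF hom] A by blast
  \<comment> \<open>Every letter of the nonempty set \<open>B\<close> occurs in \<open>w\<close> and
    survives the deletion.\<close>
  moreover have "w' \<noteq> []"
    using B unfolding w'_def filter_empty_conv by blast
  moreover have "graph (G \<restriction> A)"
    using graph.graph_induce_subgraph[OF G] A by blast
  ultimately show "G \<restriction> A \<in> representable_graphs L"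
    by (intro representable_graphsI)
qed

end
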